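(* Let $E$ be a compact metric space with Borel $\sigma$-field $\mathcal{A}$, $T:E\to E$ continuous, $\mu$ a $T$-invariant Borel probability measure such that $(E,\mathcal{A},\mu,T)$ is uniquely ergodic, $f:E\to[0,1]$ continuous with $\int_Ef\,d\mu=\frac12$ and $a=\int_E4f(1-f)\,d\mu>0$, and let $J>0$. Assume that the function $$\Lambda(u)=\int_E\log\big(f(y)e^u+(1-f(y))e^{-u}\big)\,d\mu(y),\qquad u\in\mathbb{R},$$ is even and that its derivative $\Lambda'$ is concave on $(0,+\infty)$. For $\beta>0$ let $G_\beta(s)=\frac{\beta J}{2}s^2-\Lambda(\beta Js)$ and let $\beta_c=\sup\{\beta>0: G_\beta(s)\ge0\ \forall s\in\mathbb{R}\}$. Then: 1. $\beta_c=1/(Ja)$. 2. For $0<\beta<\beta_c$, $G_\beta$ has $0$ as its unique global minimum point, of type $2$ and strength $\beta J(1-\beta Ja)$. 3. For $\beta=\beta_c$, $G_\beta$ has $0$ as its unique global minimum point, of type $\ge4$. 4. For $\beta>\beta_c$, $G_\beta$ has exactly two global minimum points $\pm m$ (with $m>0$), both of type $2$ and with the same strength. The point $m$ is the unique positive solution of the equation $$m=\int_E\frac{\tanh(\beta Jm)+(2f-1)}{1+(2f-1)\tanh(\beta Jm)}\,d\mu .$$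
   Context: Uniquely ergodic: $\mu$ is the only $T$-invariant Borel probability measure on $E$. Type and strength: for a global minimum point $m$ of the real analytic function $G_\beta$, the type is the integer $2k=\min\{j\ge1: G_\beta^{(j)}(m)\ne0\}$ and the strength is $G_\beta^{(2k)}(m)>0$. *)

theory Defs
  imports "HOL-Probability.Probability"
begin

text \<open>A compact metric space is rendered as a compact subset \<open>E\<close> of a type of class
  \<open>metric_space\<close>; its Borel sigma-field is the trace of \<open>borel\<close> on \<open>E\<close>.\<close>

definition invariant_borel_prob :: "'a::metric_space set \<Rightarrow> ('a \<Rightarrow> 'a) \<Rightarrow> 'a measure \<Rightarrow> bool" where
  "invariant_borel_prob E T \<mu> \<longleftrightarrow>
     sets \<mu> = sets (restrict_space borel E) \<and> prob_space \<mu> \<and>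
     T \<in> measurable \<mu> \<mu> \<and> distr \<mu> \<mu> T = \<mu>"

definition uniquely_ergodic :: "'a::metric_space set \<Rightarrow> ('a \<Rightarrow> 'a) \<Rightarrow> 'a measure \<Rightarrow> bool" where
  "uniquely_ergodic E T \<mu> \<longleftrightarrow>
     invariant_borel_prob E T \<mu> \<and> (\<forall>\<nu>. invariant_borel_prob E T \<nu> \<longrightarrow> \<nu> = \<mu>)"

definition Lam :: "'a measure \<Rightarrow> ('a \<Rightarrow> real) \<Rightarrow> real \<Rightarrow> real" where
  "Lam \<mu> f u = (\<integral>y. ln (f y * exp u + (1 - f y) * exp (- u)) \<partial>\<mu>)"

definition G :: "'a measure \<Rightarrow> ('a \<Rightarrow> real) \<Rightarrow> real \<Rightarrow> real \<Rightarrow> real \<Rightarrow> real" where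
  "G \<mu> f J \<beta> s = \<beta> * J / 2 * s\<^sup>2 - Lam \<mu> f (\<beta> * J * s)"

definition beta_c :: "'a measure \<Rightarrow> ('a \<Rightarrow> real) \<Rightarrow> real \<Rightarrow> real" where
  "beta_c \<mu> f J = Sup {\<beta>. \<beta> > 0 \<and> (\<forall>s. G \<mu> f J \<beta> s \<ge> 0)}"

definition global_minima :: "(real \<Rightarrow> real) \<Rightarrow> real set" where
  "global_minima g = {m. \<forall>s. g m \<le> g s}"

text \<open>\<open>has_type_strength g m n c\<close>: the global minimum point \<open>m\<close> of \<open>g\<close> has type \<open>n\<close> and
  strength \<open>c\<close>. It is a relation rather than a pair of functions because the set of orders
  with nonvanishing derivative may be empty for general \<open>g\<close>; asserting it includes that the
  minimal order exists, is even, and that the derivative of that order is positive.\<close>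

definition has_type_strength :: "(real \<Rightarrow> real) \<Rightarrow> real \<Rightarrow> nat \<Rightarrow> real \<Rightarrow> bool" where
  "has_type_strength g m n c \<longleftrightarrow>
     m \<in> global_minima g \<and> even n \<and>
     1 \<le> n \<and> (deriv ^^ n) g m \<noteq> 0 \<and> (\<forall>j. 1 \<le> j \<and> j < n \<longrightarrow> (deriv ^^ j) g m = 0) \<and>
     c = (deriv ^^ n) g m \<and> c > 0"

end

theory Submission
  imports Defs "HOL-Complex_Analysis.Complex_Analysis"
begin

text \<open>With \<open>g = 2 f - 1\<close> and \<open>t = tanh u\<close>, the derivative of \<open>Lam\<close> is the integral of
  \<open>(t + g) / (1 + g t) = g + t \<Sum>\<^sub>k (1 - g\<^sup>2) (- g)\<^sup>k t\<^sup>k\<close>. Integrating term by term gives a power series in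
  \<open>tanh u\<close>, so the derivative extends holomorphically to the strip \<open>\<bar>Im z\<bar> < pi / 4\<close>, where
  \<open>tanh\<close> has modulus less than \<open>1\<close>. It vanishes at \<open>0\<close>, has slope \<open>a\<close> there and is concave on
  the right, so it lies below \<open>a u\<close>; it lies strictly below, since equality somewhere would make
  it linear by analytic continuation, although it is bounded by \<open>1\<close>. With \<open>p = \<beta> J\<close>, the function
  \<open>V s = s - Lam' (p s)\<close> is therefore positive on \<open>(0, \<infinity>)\<close> if \<open>p a \<le> 1\<close>, and if \<open>p a > 1\<close> it is
  first negative and then, by convexity, changes sign exactly once and with positive slope. Since
  \<open>V\<close> has the sign of the derivative of \<open>G\<close>, this locates the minima. At \<open>p a = 1\<close> the type is
  finite by analyticity, even since \<open>G\<close> is even, and not \<open>2\<close>.\<close>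

subsection \<open>Real functions with a holomorphic extension to a strip\<close>

text \<open>A strip is connected, contains the whole real line and, up to its width, is preserved by
  differentiation and real rescaling. Real analyticity is thus used through the identity theorem on
  a single global domain.\<close>

definition extends_to_strip :: "(real \<Rightarrow> real) \<Rightarrow> bool" where
  "extends_to_strip g \<longleftrightarrow> (\<exists>r>0. \<exists>F. F holomorphic_on {z. \<bar>Im z\<bar> < r} \<and>
     (\<forall>x. F (complex_of_real x) = complex_of_real (g x)))"

lemma open_strip: "open {z. \<bar>Im z\<bar> < r}"
  by (intro open_Collect_less continuous_intros)

lemma connected_strip: "connected {z. \<bar>Im z\<bar> < r}"
proof -
  have "{z. \<bar>Im z\<bar> < r} = {z. Im z < r} \<inter> {z. Im z > - r}"
    by auto
  then show ?thesis
    by (simp add: convex_connected convex_Int convex_halfspace_Im_lt convex_halfspace_Im_gt)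
qed

text \<open>Restricting the complex derivative to the real axis gives the derivative of a
  complex-valued curve. Its imaginary part is the derivative of the zero function, so it vanishes,
  and its real part is the derivative of \<open>g\<close>.\<close>

lemma strip_has_real_derivative:
  assumes hol: "F holomorphic_on {z. \<bar>Im z\<bar> < r}" and "r > 0"
    and eq: "\<And>x. F (complex_of_real x) = complex_of_real (g x)"
  shows "(g has_real_derivative deriv g x) (at x)"
    and "deriv F (complex_of_real x) = complex_of_real (deriv g x)"
proof -
  have "(F has_field_derivative deriv F (of_real x)) (at (of_real x))"
    using holomorphic_derivI[OF hol open_strip] \<open>r > 0\<close> by simp
  then have "((\<lambda>x. F (of_real x)) has_vector_derivative deriv F (of_real x)) (at x)"
    by (rule has_vector_derivative_real_field)
  then have d: "((\<lambda>x. complex_of_real (g x)) has_vector_derivative deriv F (of_real x)) (at x)"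
    by (simp add: eq)
  have re: "(g has_vector_derivative Re (deriv F (of_real x))) (at x)"
    using bounded_linear.has_vector_derivative[OF bounded_linear_Re d] by simp
  have im: "((\<lambda>x. 0) has_vector_derivative Im (deriv F (of_real x))) (at x)"
    using bounded_linear.has_vector_derivative[OF bounded_linear_Im d] by simp
  have "Im (deriv F (of_real x)) = 0"
    using im has_vector_derivative_const vector_derivative_unique_at by blast
  moreover have g': "(g has_real_derivative Re (deriv F (of_real x))) (at x)"
    using re by (simp add: has_real_derivative_iff_has_vector_derivative)
  ultimately show "deriv F (complex_of_real x) = complex_of_real (deriv g x)"
    by (simp add: DERIV_imp_deriv complex_eq_iff)
  show "(g has_real_derivative deriv g x) (at x)"
    using g' by (simp add: DERIV_imp_deriv)
qed

lemma extends_to_strip_deriv: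
  assumes "extends_to_strip g"
  shows "(g has_real_derivative deriv g x) (at x)" and "extends_to_strip (deriv g)"
proof -
  obtain r F where r: "r > 0" and F: "F holomorphic_on {z. \<bar>Im z\<bar> < r}"
    and eq: "\<And>x. F (complex_of_real x) = complex_of_real (g x)"
    using assms unfolding extends_to_strip_def by blast
  show "(g has_real_derivative deriv g x) (at x)"
    using strip_has_real_derivative(1)[OF F r eq] .
  show "extends_to_strip (deriv g)"
    unfolding extends_to_strip_def
    using r holomorphic_deriv[OF F open_strip] strip_has_real_derivative(2)[OF F r eq] by blast
qed

lemma extends_to_strip_higher_deriv:
  "extends_to_strip g \<Longrightarrow> extends_to_strip ((deriv ^^ n) g)"
  by (induction n) (auto intro: extends_to_strip_deriv)

text \<open>The midpoint of the interval is a limit point of zeros of the extension, so the identity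
  theorem makes the extension vanish on the strip.\<close>

lemma extends_to_strip_eq_0_interval:
  assumes "extends_to_strip g" and "c < d" and "\<And>x. c < x \<Longrightarrow> x < d \<Longrightarrow> g x = 0"
  shows "g x = 0"
proof -
  obtain r F where r: "r > 0" and F: "F holomorphic_on {z. \<bar>Im z\<bar> < r}"
    and eq: "\<And>x. F (complex_of_real x) = complex_of_real (g x)"
    using assms unfolding extends_to_strip_def by blast
  let ?m = "(c + d) / 2"
  have "?m islimpt {c<..<d}"
    using \<open>c < d\<close> open_greaterThanLessThan by (intro interior_limit_point) auto
  then have lim: "complex_of_real ?m islimpt complex_of_real ` {c<..<d}"
    by (simp add: islimpt_isCont_image eventually_at_filter del: of_real_add of_real_divide)
  have "F (complex_of_real x) = 0"
    by (rule analytic_continuation[OF F open_strip connected_strip _ _ lim])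
      (use r assms in \<open>auto simp: eq simp del: of_real_add of_real_divide\<close>)
  then show ?thesis
    by (simp add: eq)
qed

text \<open>On the real axis the iterated complex derivatives of the extension agree with the real
  ones. The Taylor series of the extension at 0 is therefore zero, and the strip is
  connected.\<close>

lemma extends_to_strip_eq_0_derivs:
  assumes "extends_to_strip g" and "\<And>n. (deriv ^^ n) g 0 = 0"
  shows "g x = 0"
proof -
  obtain r F where r: "r > 0" and F: "F holomorphic_on {z. \<bar>Im z\<bar> < r}"
    and eq: "\<And>x. F (complex_of_real x) = complex_of_real (g x)"
    using assms unfolding extends_to_strip_def by blast
  have "(deriv ^^ n) F holomorphic_on {z. \<bar>Im z\<bar> < r} \<and>
      (\<forall>x. (deriv ^^ n) F (of_real x) = of_real ((deriv ^^ n) g x))" for n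
  proof (induction n)
    case (Suc n)
    then show ?case
      using strip_has_real_derivative(2)[OF _ r, of "(deriv ^^ n) F" "(deriv ^^ n) g"]
        holomorphic_deriv[OF _ open_strip] by auto
  qed (use F eq in auto)
  then have "(deriv ^^ n) F 0 = 0" for n
    using assms(2)[of n] by (metis of_real_0)
  then have "F (complex_of_real x) = 0"
    by (intro holomorphic_fun_eq_0_on_connected[OF F open_strip connected_strip, of 0]) (use r in auto)
  then show ?thesis
    by (simp add: eq)
qed

text \<open>This shape covers both \<open>a * x - l x\<close> and the derivative
  \<open>p * (s - l (p * s))\<close> of the functional studied below. The width of the strip is
  divided by the modulus of \<open>q\<close>.\<close>

lemma extends_to_strip_rescale:
  assumes "extends_to_strip g" and "q \<noteq> 0"
  shows "extends_to_strip (\<lambda>x. c * (d * x - g (q * x)))"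
proof -
  obtain r F where r: "r > 0" and F: "F holomorphic_on {z. \<bar>Im z\<bar> < r}"
    and eq: "\<And>x. F (complex_of_real x) = complex_of_real (g x)"
    using assms unfolding extends_to_strip_def by blast
  let ?H = "\<lambda>z. of_real c * (of_real d * z - F (of_real q * z))"
  have "(\<lambda>z. F (of_real q * z)) holomorphic_on {z. \<bar>Im z\<bar> < r / \<bar>q\<bar>}"
    by (rule holomorphic_on_compose_gen[OF _ F, of "\<lambda>z. of_real q * z", unfolded o_def])
      (use \<open>q \<noteq> 0\<close> in \<open>auto intro!: holomorphic_intros simp: abs_mult field_simps\<close>)
  then have "?H holomorphic_on {z. \<bar>Im z\<bar> < r / \<bar>q\<bar>}"
    by (intro holomorphic_intros)
  moreover have "?H (complex_of_real x) = complex_of_real (c * (d * x - g (q * x)))" for x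
    using eq[of "q * x"] by simp
  ultimately show ?thesis
    unfolding extends_to_strip_def using r \<open>q \<noteq> 0\<close>
    by (intro exI[of _ "r / \<bar>q\<bar>"] conjI exI[of _ ?H]) auto
qed

lemma extends_to_strip_smooth:
  assumes ext: "extends_to_strip (deriv g)"
    and g': "\<And>x. (g has_real_derivative deriv g x) (at x)"
  shows "((deriv ^^ n) g has_real_derivative (deriv ^^ Suc n) g x) (at x)"
proof (cases n)
  case (Suc m)
  then show ?thesis
    using extends_to_strip_deriv(1)[OF extends_to_strip_higher_deriv[OF ext, of m]]
    by (simp add: funpow_swap1)
qed (simp add: g')

section \<open>Even functions and the type of a degenerate strict minimum\<close>

lemma higher_deriv_even:
  assumes smooth: "\<And>n x. ((deriv ^^ n) g has_real_derivative (deriv ^^ Suc n) g x) (at x)"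
    and even: "\<And>x. g (- x) = g x"
  shows "(deriv ^^ n) g (- x) = (- 1) ^ n * (deriv ^^ n) g x"
proof (induction n arbitrary: x)
  case (Suc n)
  have "((\<lambda>x. (deriv ^^ n) g (- x)) has_real_derivative - (deriv ^^ Suc n) g (- x)) (at x)"
    by (rule DERIV_cong[OF DERIV_chain2[OF smooth]]) (auto intro!: derivative_eq_intros)
  moreover have "((\<lambda>x. (- 1) ^ n * (deriv ^^ n) g x) has_real_derivative
      (- 1) ^ n * (deriv ^^ Suc n) g x) (at x)"
    by (rule DERIV_cmult[OF smooth])
  ultimately have "- (deriv ^^ Suc n) g (- x) = (- 1) ^ n * (deriv ^^ Suc n) g x"
    using DERIV_unique Suc.IH by (metis (no_types, lifting) ext)
  then show ?case
    by (simp add: minus_equation_iff)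
qed (simp add: even)

text \<open>If all derivatives of positive order vanished at 0, analyticity would make
  \<open>g\<close> constant, against strictness. The least nonvanishing order is even because
  \<open>g\<close> is even, and it is not 2. The sign of that derivative comes from Taylor's
  formula.\<close>

lemma strict_minimum_type:
  assumes ext: "extends_to_strip (deriv g)"
    and g': "\<And>x. (g has_real_derivative deriv g x) (at x)"
    and even: "\<And>x. g (- x) = g x"
    and min: "\<And>x. x \<noteq> 0 \<Longrightarrow> g 0 < g x"
    and g2: "(deriv ^^ 2) g 0 = 0"
  shows "\<exists>n\<ge>4. \<exists>c. has_type_strength g 0 n c"
proof -
  note smooth = extends_to_strip_smooth[OF ext g']
  have odd0: "(deriv ^^ n) g 0 = 0" if "odd n" for n
    using higher_deriv_even[OF smooth even, of n 0] that by simp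
  have "\<exists>n. 1 \<le> n \<and> (deriv ^^ n) g 0 \<noteq> 0"
  proof (rule ccontr)
    assume "\<not> ?thesis"
    then have "(deriv ^^ Suc n) g 0 = 0" for n
      by (metis le_add1 plus_1_eq_Suc)
    then have "deriv g x = 0" for x
      by (intro extends_to_strip_eq_0_derivs[OF ext]) (simp add: funpow_swap1)
    then have "g 1 = g 0"
      using g' by (metis DERIV_isconst_all)
    then show False
      using min[of 1] by simp
  qed
  define n where "n = (LEAST n. 1 \<le> n \<and> (deriv ^^ n) g 0 \<noteq> 0)"
  have n: "1 \<le> n" "(deriv ^^ n) g 0 \<noteq> 0"
    using LeastI_ex[OF \<open>\<exists>n. 1 \<le> n \<and> (deriv ^^ n) g 0 \<noteq> 0\<close>] by (auto simp: n_def)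
  have less: "(deriv ^^ j) g 0 = 0" if "1 \<le> j" "j < n" for j
    using not_less_Least[of j "\<lambda>n. 1 \<le> n \<and> (deriv ^^ n) g 0 \<noteq> 0"] that by (auto simp: n_def)
  have "even n"
    using odd0 n(2) by blast
  have "n \<noteq> 2"
    using g2 n(2) by auto
  have "n \<ge> 4"
  proof -
    have "n \<noteq> 1" "n \<noteq> 3" using \<open>even n\<close> by auto
    then show ?thesis using n(1) \<open>n \<noteq> 2\<close> by linarith
  qed
  have "(deriv ^^ n) g 0 > 0"
  proof (rule ccontr)
    assume "\<not> ?thesis"
    then have neg: "(deriv ^^ n) g 0 < 0"
      using n(2) by simp
    have "isCont ((deriv ^^ n) g) 0"
      using smooth[of n 0] DERIV_isCont by blast
    then have "\<forall>\<^sub>F x in at 0. (deriv ^^ n) g x < 0"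
      using neg order_tendstoD(2) isContD by blast
    then obtain d where d: "d > 0" "\<And>x. x \<noteq> 0 \<Longrightarrow> dist x 0 < d \<Longrightarrow> (deriv ^^ n) g x < 0"
      unfolding eventually_at by blast
    \<comment> \<open>Expanding at \<open>d / 2\<close> keeps the intermediate point
      \<open>t\<close> where the derivative of order \<open>n\<close> is negative. The terms of
      orders 1 to \<open>n - 1\<close> vanish, so \<open>g (d / 2)\<close> is \<open>g 0\<close>
      plus a negative remainder.\<close>
    obtain t where t: "0 < t" "t < d / 2"
      "g (d / 2) = (\<Sum>m<n. (deriv ^^ m) g 0 / fact m * (d / 2) ^ m)
        + (deriv ^^ n) g t / fact n * (d / 2) ^ n"
      using Maclaurin[of "d / 2" n "\<lambda>m. (deriv ^^ m) g" g] d(1) n(1) smooth by auto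
    have "(\<Sum>m<n. (deriv ^^ m) g 0 / fact m * (d / 2) ^ m)
        = (\<Sum>m\<in>{0}. (deriv ^^ m) g 0 / fact m * (d / 2) ^ m)"
      by (rule sum.mono_neutral_right) (use n(1) less in auto)
    moreover have "(deriv ^^ n) g t / fact n * (d / 2) ^ n < 0"
      using d(1) d(2)[of t] t(1,2) by (intro mult_neg_pos divide_neg_pos) auto
    ultimately have "g (d / 2) < g 0"
      using t(3) by simp
    then show False
      using min[of "d / 2"] d(1) by simp
  qed
  moreover have "g 0 \<le> g s" for s
    using min[of s] by (cases "s = 0") auto
  then have "0 \<in> global_minima g"
    by (simp add: global_minima_def)
  ultimately show ?thesis
    unfolding has_type_strength_def using \<open>n \<ge> 4\<close> \<open>even n\<close> n less by blast
qed

subsection \<open>The log-Laplace function of a random field\<close>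

text \<open>By the mean value inequality the difference quotients are bounded by the constant
  \<open>B\<close>, which is integrable for a finite measure. Dominated convergence along sequences
  then gives the limit.\<close>

lemma (in finite_measure) has_real_derivative_integral:
  fixes h h' :: "real \<Rightarrow> 'a \<Rightarrow> real"
  assumes int: "\<And>u. integrable M (h u)"
    and meas: "\<And>u. h' u \<in> borel_measurable M"
    and der: "\<And>u y. y \<in> space M \<Longrightarrow> ((\<lambda>u. h u y) has_real_derivative h' u y) (at u)"
    and bound: "\<And>u y. y \<in> space M \<Longrightarrow> \<bar>h' u y\<bar> \<le> B"
  shows "((\<lambda>u. \<integral>y. h u y \<partial>M) has_real_derivative (\<integral>y. h' u y \<partial>M)) (at u)"
  unfolding has_field_derivative_iff tendsto_at_iff_sequentially o_def
proof (intro allI impI)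
  fix X :: "nat \<Rightarrow> real"
  assume X: "\<forall>i. X i \<in> UNIV - {u}" "X \<longlonglongrightarrow> u"
  have quot: "((\<integral>y. h (X n) y \<partial>M) - (\<integral>y. h u y \<partial>M)) / (X n - u)
      = (\<integral>y. (h (X n) y - h u y) / (X n - u) \<partial>M)" for n
    using int by simp
  show "(\<lambda>n. ((\<integral>y. h (X n) y \<partial>M) - (\<integral>y. h u y \<partial>M)) / (X n - u)) \<longlonglongrightarrow> (\<integral>y. h' u y \<partial>M)"
    unfolding quot
  proof (rule integral_dominated_convergence[where w = "\<lambda>_. B"])
    show "(\<lambda>y. (h (X n) y - h u y) / (X n - u)) \<in> borel_measurable M" for n
      using borel_measurable_integrable[OF int] by (intro measurable) auto
    show "AE y in M. (\<lambda>n. (h (X n) y - h u y) / (X n - u)) \<longlonglongrightarrow> h' u y"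
      using der[of _ u] X
      unfolding has_field_derivative_iff tendsto_at_iff_sequentially o_def by (intro AE_I2) blast
    show "AE y in M. norm ((h (X n) y - h u y) / (X n - u)) \<le> B" for n
    proof (intro AE_I2)
      fix y assume y: "y \<in> space M"
      have "norm (h (X n) y - h u y) \<le> B * norm (X n - u)"
        by (rule field_differentiable_bound[of UNIV "\<lambda>u. h u y" "\<lambda>u. h' u y"])
          (use der y bound in auto)
      then show "norm ((h (X n) y - h u y) / (X n - u)) \<le> B"
        using X(1) by (simp add: pos_divide_le_eq)
    qed
  qed (use meas in auto)
qed

text \<open>With \<open>w = exp (2 * z)\<close> one has \<open>tanh z = (w - 1) / (w + 1)\<close>,
  the Cayley transform, which maps the right half-plane into the unit disc. The bound on
  \<open>Im z\<close> says that \<open>w\<close> has argument of modulus below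
  \<open>pi / 2\<close>.\<close>

lemma norm_tanh_less_1:
  fixes z :: complex
  assumes "\<bar>Im z\<bar> < pi / 4"
  shows "norm (tanh z) < 1" and "cosh z \<noteq> 0"
proof -
  let ?w = "exp (2 * z)"
  have "cos (2 * Im z) > 0"
    using assms by (intro cos_gt_zero_pi) auto
  then have Re: "Re ?w > 0"
    by (simp add: Re_exp)
  have exp: "exp (- z) * (?w + 1) = 2 * cosh z" "exp (- z) * (?w - 1) = 2 * sinh z"
    by (simp_all add: cosh_def sinh_def algebra_simps scaleR_conv_of_real flip: exp_add)
  have ne: "?w + 1 \<noteq> 0"
    using Re by (auto simp: add_eq_0_iff2)
  then show "cosh z \<noteq> 0"
    using exp(1) by auto
  have "tanh z = (2 * sinh z) / (2 * cosh z)"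
    by (simp add: tanh_def)
  also have "\<dots> = (?w - 1) / (?w + 1)"
    unfolding exp[symmetric] by simp
  finally have tanh: "tanh z = (?w - 1) / (?w + 1)" .
  have "(norm (?w - 1))\<^sup>2 < (norm (?w + 1))\<^sup>2"
    unfolding cmod_power2 using Re by (simp add: power2_eq_square algebra_simps)
  then have "norm (?w - 1) < norm (?w + 1)"
    using norm_ge_zero power2_less_imp_less by blast
  then show "norm (tanh z) < 1"
    using ne by (simp add: tanh norm_divide)
qed

section \<open>Derivative of the log-Laplace function and its expansion in powers of tanh\<close>

locale random_field = prob_space M for M :: "'a measure" +
  fixes f :: "'a \<Rightarrow> real"
  assumes measurable_f [measurable]: "f \<in> borel_measurable M"
    and f_bounds: "\<And>y. y \<in> space M \<Longrightarrow> 0 \<le> f y \<and> f y \<le> 1"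
begin

definition dLam :: "real \<Rightarrow> real" where
  "dLam u = (\<integral>y. (tanh u + (2 * f y - 1)) / (1 + (2 * f y - 1) * tanh u) \<partial>M)"

text \<open>With \<open>g = 2 * f - 1\<close> the integrand is \<open>(1 - g^2) * (- g)^k\<close>,
  the coefficient in the geometric expansion of \<open>(1 - g^2) / (1 + g * t)\<close>. The case
  \<open>k = 0\<close> is the constant \<open>a\<close> of the theorem.\<close>

definition moment :: "nat \<Rightarrow> real" where
  "moment k = (\<integral>y. 4 * f y * (1 - f y) * (1 - 2 * f y) ^ k \<partial>M)"

lemma integrable_bounded:
  assumes [measurable]: "h \<in> borel_measurable M" and "\<And>y. y \<in> space M \<Longrightarrow> \<bar>h y\<bar> \<le> B"
  shows "integrable M (h :: 'a \<Rightarrow> real)"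
  by (rule integrable_const_bound[of _ B]) (use assms in auto)

lemma abs_integral_le_1:
  assumes [measurable]: "h \<in> borel_measurable M" and "\<And>y. y \<in> space M \<Longrightarrow> \<bar>h y\<bar> \<le> 1"
  shows "\<bar>\<integral>y. h y \<partial>M\<bar> \<le> (1 :: real)"
proof -
  have "\<bar>\<integral>y. h y \<partial>M\<bar> \<le> (\<integral>y. \<bar>h y\<bar> \<partial>M)"
    by (rule integral_abs_bound)
  also have "\<dots> \<le> (\<integral>y. 1 \<partial>M)"
    using assms by (intro integral_mono integrable_abs integrable_bounded[of h 1]) auto
  finally show ?thesis
    by (simp add: prob_space)
qed

lemma abs_centred: "y \<in> space M \<Longrightarrow> \<bar>2 * f y - 1\<bar> \<le> 1"
  using f_bounds[of y] by auto

lemma denominator_pos: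
  assumes "y \<in> space M" and "\<bar>t\<bar> < 1"
  shows "1 + (2 * f y - 1) * t > 0"
proof -
  have "\<bar>(2 * f y - 1) * t\<bar> \<le> 1 * \<bar>t\<bar>"
    unfolding abs_mult using abs_centred[OF assms(1)] by (intro mult_right_mono) auto
  then show ?thesis
    using assms(2) by linarith
qed

lemma abs_tanh: "\<bar>tanh (u::real)\<bar> < 1"
  using tanh_real_bounds[of u] by (auto simp: abs_if)

text \<open>For \<open>g\<close> and \<open>t\<close> in [-1, 1], expanding
  \<open>(1 - g) * (1 - t) >= 0\<close> and \<open>(1 + g) * (1 + t) >= 0\<close> bounds
  \<open>t + g\<close> and its negative by \<open>1 + g * t\<close>.\<close>

lemma integrand_bound:
  assumes "y \<in> space M"
  shows "\<bar>(tanh u + (2 * f y - 1)) / (1 + (2 * f y - 1) * tanh u)\<bar> \<le> 1"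
proof -
  let ?g = "2 * f y - 1" and ?t = "tanh u"
  have d: "1 + ?g * ?t > 0"
    using denominator_pos[OF assms abs_tanh] .
  have "0 \<le> (1 - ?g) * (1 - ?t)" "0 \<le> (1 + ?g) * (1 + ?t)"
    using abs_centred[OF assms] abs_tanh[of u] by (auto intro!: mult_nonneg_nonneg)
  then have "\<bar>?t + ?g\<bar> \<le> 1 + ?g * ?t"
    by (simp add: algebra_simps abs_if)
  then show ?thesis
    using d by (simp add: abs_divide)
qed

lemma measurable_integrand [measurable]:
  "(\<lambda>y. (tanh u + (2 * f y - 1)) / (1 + (2 * f y - 1) * tanh u)) \<in> borel_measurable M"
  by measurable

lemma abs_dLam: "\<bar>dLam u\<bar> \<le> 1"
  unfolding dLam_def by (rule abs_integral_le_1[OF measurable_integrand integrand_bound])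

text \<open>The middle term is a convex combination of \<open>exp u\<close> and
  \<open>exp (- u)\<close>. The bounds make its logarithm well defined and at most the modulus of
  \<open>u\<close> in absolute value, hence integrable.\<close>

lemma log_argument_bounds:
  assumes "y \<in> space M"
  shows "exp (- \<bar>u\<bar>) \<le> f y * exp u + (1 - f y) * exp (- u)"
    and "f y * exp u + (1 - f y) * exp (- u) \<le> exp \<bar>u\<bar>"
proof -
  have f: "0 \<le> f y" "0 \<le> 1 - f y"
    using f_bounds[OF assms] by auto
  have "f y * exp (- \<bar>u\<bar>) + (1 - f y) * exp (- \<bar>u\<bar>) \<le> f y * exp u + (1 - f y) * exp (- u)"
    using f by (intro add_mono mult_left_mono) auto
  then show "exp (- \<bar>u\<bar>) \<le> f y * exp u + (1 - f y) * exp (- u)"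
    by (simp add: algebra_simps)
  have "f y * exp u + (1 - f y) * exp (- u) \<le> f y * exp \<bar>u\<bar> + (1 - f y) * exp \<bar>u\<bar>"
    using f by (intro add_mono mult_left_mono) auto
  then show "f y * exp u + (1 - f y) * exp (- u) \<le> exp \<bar>u\<bar>"
    by (simp add: algebra_simps)
qed

lemma Lam_has_derivative: "(Lam M f has_real_derivative dLam u) (at u)"
proof -
  let ?E = "\<lambda>u y. f y * exp u + (1 - f y) * exp (- u)"
  have pos: "?E u y > 0" if "y \<in> space M" for u y
    using log_argument_bounds(1)[OF that, of u] exp_gt_zero[of "- \<bar>u\<bar>"] by linarith
  have "((\<lambda>u. \<integral>y. ln (?E u y) \<partial>M) has_real_derivative dLam u) (at u)"
    unfolding dLam_def
  proof (rule has_real_derivative_integral[OF _ measurable_integrand _ integrand_bound])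
    fix u
    show "integrable M (\<lambda>y. ln (?E u y))"
    proof (rule integrable_bounded)
      fix y assume y: "y \<in> space M"
      have "ln (exp (- \<bar>u\<bar>)) \<le> ln (?E u y)"
        using log_argument_bounds(1)[OF y, of u] pos[OF y, of u] by (subst ln_le_cancel_iff) auto
      moreover have "ln (?E u y) \<le> ln (exp \<bar>u\<bar>)"
        using log_argument_bounds(2)[OF y, of u] pos[OF y, of u] by (subst ln_le_cancel_iff) auto
      ultimately show "\<bar>ln (?E u y)\<bar> \<le> \<bar>u\<bar>"
        by simp
    qed measurable
  next
    fix u y assume y: "y \<in> space M"
    let ?N = "f y * exp u - (1 - f y) * exp (- u)"
    \<comment> \<open>Multiplying numerator and denominator by \<open>cosh u\<close> turns the
      fraction into the logarithmic derivative of the argument of \<open>ln\<close>.\<close>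
    have "(tanh u + (2 * f y - 1)) / (1 + (2 * f y - 1) * tanh u)
        = (cosh u * (tanh u + (2 * f y - 1))) / (cosh u * (1 + (2 * f y - 1) * tanh u))"
      by simp
    also have "cosh u * (tanh u + (2 * f y - 1)) = ?N"
      by (simp add: tanh_def distrib_left) (simp add: sinh_def cosh_def field_simps)
    also have "cosh u * (1 + (2 * f y - 1) * tanh u) = ?E u y"
      by (simp add: tanh_def distrib_left) (simp add: sinh_def cosh_def field_simps)
    finally have eq: "(tanh u + (2 * f y - 1)) / (1 + (2 * f y - 1) * tanh u) = ?N / ?E u y" .
    show "((\<lambda>u. ln (?E u y)) has_real_derivative
        (tanh u + (2 * f y - 1)) / (1 + (2 * f y - 1) * tanh u)) (at u)"
      unfolding eq using pos[OF y, of u] by (auto intro!: derivative_eq_intros)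
  qed
  then show ?thesis
    by (simp add: Lam_def[abs_def])
qed

lemma moment_summand_bound:
  assumes "y \<in> space M"
  shows "\<bar>4 * f y * (1 - f y) * (1 - 2 * f y) ^ k\<bar> \<le> 1"
proof -
  have "0 \<le> f y" "0 \<le> 1 - f y"
    using f_bounds[OF assms] by auto
  moreover have "4 * f y * (1 - f y) \<le> 1"
    using zero_le_power2[of "2 * f y - 1"] by (simp add: power2_eq_square algebra_simps)
  moreover have "\<bar>1 - 2 * f y\<bar> ^ k \<le> 1"
    using f_bounds[OF assms] by (intro power_le_one) auto
  ultimately show ?thesis
    by (simp add: abs_mult power_abs mult_le_one)
qed

lemma abs_moment: "\<bar>moment k\<bar> \<le> 1"
  unfolding moment_def by (rule abs_integral_le_1) (use moment_summand_bound in auto)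

text \<open>Pointwise this is the geometric series with ratio \<open>(1 - 2 * f y) * tanh u\<close>.
  The majorant with terms the powers of the modulus of \<open>tanh u\<close> permits termwise
  integration. The division by \<open>tanh u\<close> is why 0 is excluded.\<close>

lemma dLam_series:
  "(\<lambda>k. moment k * tanh u ^ k) sums ((dLam u - (\<integral>y. 2 * f y - 1 \<partial>M)) / tanh u)"
  if "u \<noteq> 0"
proof -
  let ?t = "tanh u"
  let ?s = "\<lambda>k y. 4 * f y * (1 - f y) * (1 - 2 * f y) ^ k * ?t ^ k"
  have t: "?t \<noteq> 0" "\<bar>?t\<bar> < 1"
    using that abs_tanh by auto
  have bound: "\<bar>?s k y\<bar> \<le> \<bar>?t\<bar> ^ k" if "y \<in> space M" for k y
  proof -
    have "\<bar>4 * f y * (1 - f y) * (1 - 2 * f y) ^ k\<bar> * \<bar>?t ^ k\<bar> \<le> 1 * \<bar>?t ^ k\<bar>"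
      using moment_summand_bound[OF that] by (intro mult_right_mono) auto
    then show ?thesis
      by (simp add: abs_mult power_abs)
  qed
  have int: "integrable M (?s k)" for k
    by (rule integrable_bounded[where B = "\<bar>?t\<bar> ^ k"]) (use bound in auto)
  have geo: "summable (\<lambda>k. \<bar>?t\<bar> ^ k)"
    using t by (intro summable_geometric) simp
  have "(\<lambda>k. \<integral>y. ?s k y \<partial>M) sums (\<integral>y. (\<Sum>k. ?s k y) \<partial>M)"
  proof (rule sums_integral[OF int])
    show "AE y in M. summable (\<lambda>k. norm (?s k y))"
      by (intro AE_I2 summable_comparison_test'[OF geo, of 0]) (simp add: bound)
    have "(\<integral>y. norm (?s k y) \<partial>M) \<le> \<bar>?t\<bar> ^ k" for k
    proof -
      have "(\<integral>y. norm (?s k y) \<partial>M) \<le> (\<integral>y. \<bar>?t\<bar> ^ k \<partial>M)"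
        using bound int by (intro integral_mono integrable_norm) auto
      then show ?thesis
        by (simp add: prob_space)
    qed
    then show "summable (\<lambda>k. \<integral>y. norm (?s k y) \<partial>M)"
      by (intro summable_comparison_test'[OF geo, of 0]) simp
  qed
  also have "(\<integral>y. (\<Sum>k. ?s k y) \<partial>M)
      = (\<integral>y. ((tanh u + (2 * f y - 1)) / (1 + (2 * f y - 1) * tanh u) - (2 * f y - 1)) / ?t \<partial>M)"
  proof (rule Bochner_Integration.integral_cong[OF refl])
    fix y assume y: "y \<in> space M"
    let ?q = "(1 - 2 * f y) * ?t"
    have "\<bar>?q\<bar> \<le> 1 * \<bar>?t\<bar>"
      unfolding abs_mult using abs_centred[OF y] by (intro mult_right_mono) auto
    then have "norm ?q < 1"
      using t by simp
    then have "(\<lambda>k. 4 * f y * (1 - f y) * ?q ^ k) sums (4 * f y * (1 - f y) * (1 / (1 - ?q)))"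
      by (intro sums_mult geometric_sums)
    then have "(\<Sum>k. ?s k y) = 4 * f y * (1 - f y) / (1 - ?q)"
      by (simp add: sums_iff power_mult_distrib mult.assoc)
    also have "1 - ?q = 1 + (2 * f y - 1) * ?t"
      by (simp add: algebra_simps)
    also have "4 * f y * (1 - f y) / (1 + (2 * f y - 1) * ?t)
        = ((?t + (2 * f y - 1)) / (1 + (2 * f y - 1) * ?t) - (2 * f y - 1)) / ?t"
      using denominator_pos[OF y t(2)] t(1) by (simp add: divide_simps) (simp add: algebra_simps)
    finally show "(\<Sum>k. ?s k y)
        = ((?t + (2 * f y - 1)) / (1 + (2 * f y - 1) * ?t) - (2 * f y - 1)) / ?t" .
  qed
  also have "\<dots> = (dLam u - (\<integral>y. 2 * f y - 1 \<partial>M)) / ?t"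
    unfolding dLam_def
    by (subst integral_divide_zero, subst Bochner_Integration.integral_diff)
      (auto intro!: integrable_bounded integrand_bound abs_centred)
  finally show ?thesis
    by (simp add: moment_def)
qed

lemma dLam_0: "dLam 0 = (\<integral>y. 2 * f y - 1 \<partial>M)"
  by (simp add: dLam_def)

text \<open>The moments are bounded by 1, so their power series \<open>P\<close> is holomorphic on
  the unit disc, into which \<open>tanh\<close> maps the strip. The extension is
  \<open>dLam 0 + tanh z * P (tanh z)\<close>, with derivative \<open>P 0\<close> at 0.\<close>

lemma
  shows dLam_extends: "extends_to_strip dLam"
    and dLam_has_derivative_0: "(dLam has_real_derivative moment 0) (at 0)"
proof -
  define P where "P w = (\<Sum>k. complex_of_real (moment k) * w ^ k)" for w
  define F where "F z = of_real (dLam 0) + tanh z * P (tanh z)" for z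
  have sums: "(\<lambda>k. complex_of_real (moment k) * w ^ k) sums P w" if "norm w < 1" for w
    unfolding P_def
  proof (rule summable_sums, rule summable_comparison_test'[of "\<lambda>k. norm w ^ k" 0])
    show "summable (\<lambda>k. norm w ^ k)"
      using that by (intro summable_geometric) simp
    show "norm (complex_of_real (moment k) * w ^ k) \<le> norm w ^ k" for k
      using mult_right_mono[OF abs_moment[of k], of "norm w ^ k"] by (simp add: norm_mult norm_power)
  qed
  have P: "P holomorphic_on ball 0 1"
    by (rule power_series_holomorphic[of _ _ "\<lambda>k. complex_of_real (moment k)"]) (use sums in auto)
  have tanh: "tanh holomorphic_on {z :: complex. \<bar>Im z\<bar> < pi / 4}"
    unfolding holomorphic_on_def field_differentiable_def mem_Collect_eq
  proof (intro ballI exI)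
    fix z :: complex assume "z \<in> {z. \<bar>Im z\<bar> < pi / 4}"
    then have "cosh z \<noteq> 0"
      using norm_tanh_less_1(2) by simp
    from has_field_derivative_tanh[OF this DERIV_ident]
    show "(tanh has_field_derivative (1 - (tanh z)\<^sup>2) * 1) (at z within {z. \<bar>Im z\<bar> < pi / 4})"
      by (rule has_field_derivative_at_within)
  qed
  have "(P \<circ> tanh) holomorphic_on {z. \<bar>Im z\<bar> < pi / 4}"
    by (rule holomorphic_on_compose_gen[OF tanh P]) (use norm_tanh_less_1 in auto)
  then have F: "F holomorphic_on {z. \<bar>Im z\<bar> < pi / 4}"
    unfolding F_def using tanh by (intro holomorphic_intros) (auto simp: o_def)
  have F_eq: "F (complex_of_real x) = complex_of_real (dLam x)" for x
  \<comment> \<open>The integrated series determines the value only for nonzero \<open>x\<close>; at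
    0 the factor \<open>tanh\<close> vanishes and only the constant term remains.\<close>
  proof (cases "x = 0")
    case False
    have "norm (tanh (complex_of_real x)) < 1"
      by (rule norm_tanh_less_1) simp
    then have "(\<lambda>k. complex_of_real (moment k) * tanh (complex_of_real x) ^ k) sums P (tanh (of_real x))"
      by (rule sums)
    moreover have "(\<lambda>k. complex_of_real (moment k * tanh x ^ k)) sums
        of_real ((dLam x - dLam 0) / tanh x)"
      using dLam_series[OF False] by (simp only: sums_of_real_iff dLam_0)
    moreover have tanh_x: "tanh (complex_of_real x) = of_real (tanh x)"
      by (simp add: tanh_altdef exp_of_real flip: of_real_minus)
    ultimately have "P (of_real (tanh x)) = of_real ((dLam x - dLam 0) / tanh x)"
      using sums_unique2 by (simp only: of_real_mult of_real_power)
    then show ?thesis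
      using False by (simp add: F_def tanh_x)
  qed (simp add: F_def)
  show ext: "extends_to_strip dLam"
    unfolding extends_to_strip_def by (rule exI[of _ "pi / 4"]) (use F F_eq in auto)
  have "(P has_field_derivative deriv P (tanh 0)) (at (tanh 0))"
    using holomorphic_derivI[OF P, of 0] by simp
  then have "(F has_field_derivative P 0) (at 0)"
    unfolding F_def by (auto intro!: derivative_eq_intros DERIV_chain2[where g = tanh])
  moreover have "P 0 = of_real (moment 0)"
    using powser_zero[of "\<lambda>k. complex_of_real (moment k)"] by (simp add: P_def)
  ultimately have "deriv F 0 = of_real (moment 0)"
    by (simp add: DERIV_imp_deriv)
  moreover have "deriv F (of_real 0) = of_real (deriv dLam 0)"
    by (rule strip_has_real_derivative(2)[OF F _ F_eq]) simp
  ultimately have "deriv dLam 0 = moment 0"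
    by simp
  then show "(dLam has_real_derivative moment 0) (at 0)"
    using extends_to_strip_deriv(1)[OF ext, of 0] by simp
qed

end

subsection \<open>Minima of the mean-field functional\<close>

lemma has_type_strength_2I:
  assumes "m \<in> global_minima g" and "deriv g m = 0" and "(deriv ^^ 2) g m = c" and "c > 0"
  shows "has_type_strength g m 2 c"
proof -
  have "j = 1" if "1 \<le> j" "j < 2" for j :: nat
    using that by simp
  then show ?thesis
    unfolding has_type_strength_def using assms by (auto simp: less_2_cases_iff)
qed

text \<open>The chord inequality with denominators cleared, so that the sign at one of the three
  points can be read off from the other two.\<close>

lemma convex_on_three_points:
  fixes x y z :: real
  assumes "convex_on A g" and "x \<in> A" "z \<in> A" and "x < y" "y < z"
  shows "(z - x) * g y \<le> (z - y) * g x + (y - x) * g z"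
proof -
  define t where "t = (y - x) / (z - x)"
  have t: "0 \<le> t" "t \<le> 1"
    using assms by (auto simp: t_def)
  have zx: "(z - x) * t = y - x"
    using assms by (simp add: t_def)
  then have y: "(1 - t) * x + t * z = y"
    by (simp add: algebra_simps)
  have "g y \<le> (1 - t) * g x + t * g z"
    using convex_onD[OF assms(1) t assms(2,3)] y by simp
  then have "(z - x) * g y \<le> (z - x) * ((1 - t) * g x + t * g z)"
    using assms by (intro mult_left_mono) auto
  also have "\<dots> = ((z - x) - (z - x) * t) * g x + (z - x) * t * g z"
    by (simp add: algebra_simps)
  finally show ?thesis
    by (simp add: zx)
qed

text \<open>\<open>L\<close> and \<open>l\<close> stand for \<open>Lam\<close> and its derivative.
  The measure enters the study of the minima only through these properties.\<close>

locale mean_field =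
  fixes L l :: "real \<Rightarrow> real" and a :: real
  assumes L_has_derivative: "(L has_real_derivative l u) (at u)"
    and L_even: "L (- u) = L u"
    and l_extends: "extends_to_strip l"
    and l_bound: "\<bar>l u\<bar> \<le> 1"
    and l_has_derivative_0: "(l has_real_derivative a) (at 0)"
    and a_pos: "a > 0"
    and l_concave: "concave_on {0<..} l"
begin

section \<open>Comparison of \<open>l\<close> with linear functions\<close>

lemma l_has_derivative: "(l has_real_derivative deriv l u) (at u)"
  by (rule extends_to_strip_deriv(1)[OF l_extends])

lemma isCont_l: "isCont l u"
  by (rule DERIV_isCont[OF l_has_derivative])

lemma l_odd: "l (- u) = - l u"
proof -
  have "((\<lambda>u. L (- u)) has_real_derivative - l (- u)) (at u)"
    by (rule DERIV_cong[OF DERIV_chain2[OF L_has_derivative]]) (auto intro!: derivative_eq_intros)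
  then have "(L has_real_derivative - l (- u)) (at u)"
    by (simp add: L_even)
  from DERIV_unique[OF this L_has_derivative] show ?thesis
    by simp
qed

lemma l_0: "l 0 = 0"
  using l_odd[of 0] by simp

text \<open>Concavity is available only on the open half-line, so it is applied between
  \<open>e > 0\<close> and \<open>u\<close>; letting \<open>e\<close> tend to 0 and using
  \<open>l 0 = 0\<close> gives the claim.\<close>

lemma l_scale:
  assumes "0 \<le> t" "t \<le> 1" "0 < u"
  shows "t * l u \<le> l (t * u)"
proof (cases "t = 0")
  case False
  have "((\<lambda>e. (1 - t) * l e + t * l u) \<longlongrightarrow> (1 - t) * l 0 + t * l u) (at_right 0)"
    using isCont_l[of 0] by (auto intro!: tendsto_intros simp: isCont_def filterlim_at_split)
  moreover have "((\<lambda>e. l ((1 - t) * e + t * u)) \<longlongrightarrow> l ((1 - t) * 0 + t * u)) (at_right 0)"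
    by (intro isCont_tendsto_compose[OF isCont_l] tendsto_intros)
  moreover have "\<forall>\<^sub>F e in at_right 0. (1 - t) * l e + t * l u \<le> l ((1 - t) * e + t * u)"
    using eventually_at_right_less
  proof (rule eventually_mono)
    fix e :: real assume "0 < e"
    then show "(1 - t) * l e + t * l u \<le> l ((1 - t) * e + t * u)"
      using convex_onD[OF l_concave[unfolded concave_on_def] assms(1,2), of e u] \<open>u > 0\<close> by simp
  qed
  ultimately have "(1 - t) * l 0 + t * l u \<le> l ((1 - t) * 0 + t * u)"
    by (intro tendsto_le[OF trivial_limit_at_right_real])
  then show ?thesis
    by (simp add: l_0)
qed (simp add: l_0)

text \<open>By \<open>l_scale\<close> the slope \<open>l h / h\<close> does not increase with
  \<open>h\<close>, so its value at \<open>u\<close> is at most its limit \<open>a\<close> at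
  0.\<close>

lemma l_le:
  assumes "u \<ge> 0"
  shows "l u \<le> a * u"
proof (cases "u = 0")
  case False
  have "((\<lambda>h. l h / h) \<longlongrightarrow> a) (at_right 0)"
    using l_has_derivative_0
    by (auto simp: has_field_derivative_iff l_0 filterlim_at_split)
  moreover have "\<forall>\<^sub>F h in at_right 0. l u / u \<le> l h / h"
    unfolding eventually_at_right_field
  proof (intro exI[of _ u] conjI allI impI)
    fix h assume h: "0 < h" "h < u"
    then have "h / u * l u \<le> l (h / u * u)"
      by (intro l_scale) auto
    then show "l u / u \<le> l h / h"
      using h by (simp add: field_simps)
  qed (use False assms in auto)
  ultimately have "l u / u \<le> a"
    by (intro tendsto_lowerbound[of _ a "at_right 0"]) auto
  then show ?thesis
    using False assms by (simp add: field_simps)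
qed (simp add: l_0)

text \<open>Equality at one point forces \<open>l\<close> to be linear near \<open>0\<close>, hence everywhere by analyticity,
  against its boundedness.\<close>

lemma l_less:
  assumes "u > 0"
  shows "l u < a * u"
proof (rule ccontr)
  assume "\<not> ?thesis"
  then have eq: "l u = a * u"
    using l_le[of u] assms by simp
  have "l x = a * x" if "0 < x" "x < u" for x
  proof -
    have "x / u * l u \<le> l (x / u * u)"
      using that by (intro l_scale) auto
    then show ?thesis
      using eq l_le[of x] that by (simp add: mult.commute)
  qed
  moreover have "extends_to_strip (\<lambda>x. a * x - l x)"
    using extends_to_strip_rescale[OF l_extends, of 1 1 a] by simp
  \<comment> \<open>At \<open>2 / a\<close> the linear function takes the value 2, beyond the bound
    1 for \<open>l\<close>.\<close>
  ultimately have "a * (2 / a) - l (2 / a) = 0"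
    using extends_to_strip_eq_0_interval[of "\<lambda>x. a * x - l x" 0 u "2 / a"] assms by simp
  then show False
    using l_bound[of "2 / a"] a_pos by simp
qed

section \<open>The functional \<open>G\<close> in terms of the single parameter \<open>p\<close>,
  the product of \<beta> and \<open>J\<close>\<close>

definition H :: "real \<Rightarrow> real \<Rightarrow> real" where
  "H p s = p / 2 * s\<^sup>2 - L (p * s)"

lemma H_has_derivative: "(H p has_real_derivative p * (s - l (p * s))) (at s)"
  unfolding H_def[abs_def]
  by (rule DERIV_cong, (rule derivative_intros DERIV_chain2[OF L_has_derivative])+)
    (simp add: algebra_simps)

lemma continuous_on_H: "continuous_on A (H p)"
  by (intro continuous_at_imp_continuous_on ballI DERIV_isCont[OF H_has_derivative])

lemma deriv_H: "deriv (H p) = (\<lambda>s. p * (s - l (p * s)))"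
  by (rule ext) (rule DERIV_imp_deriv[OF H_has_derivative])

lemma H_even: "H p (- s) = H p s"
  by (simp add: H_def L_even)

lemma V_has_derivative:
  "((\<lambda>s. s - l (p * s)) has_real_derivative 1 - p * deriv l (p * s)) (at s)"
  by (rule DERIV_cong, (rule derivative_intros DERIV_chain2[OF l_has_derivative])+) simp

lemma deriv2_H: "(deriv ^^ 2) (H p) s = p * (1 - p * deriv l (p * s))"
  using DERIV_imp_deriv[OF DERIV_cmult[OF V_has_derivative, of p]]
  by (simp add: numeral_2_eq_2 deriv_H)

lemma H_extends: "p \<noteq> 0 \<Longrightarrow> extends_to_strip (deriv (H p))"
  using extends_to_strip_rescale[OF l_extends, of p p 1] by (simp add: deriv_H)

lemma deriv_l_0: "deriv l 0 = a"
  by (rule DERIV_imp_deriv[OF l_has_derivative_0])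

lemma H_increasing:
  assumes "p > 0" and "0 \<le> s" "s < t" and "\<And>x. s < x \<Longrightarrow> l (p * x) < x"
  shows "H p s < H p t"
  by (rule DERIV_pos_imp_increasing_open[OF \<open>s < t\<close>])
    (use assms H_has_derivative[of p] in \<open>auto intro!: exI mult_pos_pos continuous_on_H\<close>)

lemma H_decreasing:
  assumes "p > 0" and "s < t" and "\<And>x. s < x \<Longrightarrow> x < t \<Longrightarrow> x < l (p * x)"
  shows "H p t < H p s"
  by (rule DERIV_neg_imp_decreasing_open[OF \<open>s < t\<close>])
    (use assms H_has_derivative[of p] in \<open>auto intro!: exI mult_pos_neg continuous_on_H\<close>)

text \<open>The strict bound on \<open>l\<close> at \<open>p * x\<close> gives
  \<open>l (p * x) < x\<close> even when \<open>p * a = 1\<close>. So \<open>H p\<close> increases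
  on the right half-line, and evenness covers the left one.\<close>

lemma subcritical_minimum:
  assumes "p > 0" and "p * a \<le> 1" and "s \<noteq> 0"
  shows "H p 0 < H p s"
proof -
  have "l (p * x) < x" if "0 < x" for x
  proof -
    have "l (p * x) < a * (p * x)"
      using assms that by (intro l_less) simp
    also have "\<dots> \<le> x"
      using mult_right_mono[OF assms(2), of x] that by (simp add: algebra_simps)
    finally show ?thesis .
  qed
  then have "H p 0 < H p \<bar>s\<bar>"
    using assms by (intro H_increasing) auto
  then show ?thesis
    using H_even[of p s] by (simp add: abs_if split: if_splits)
qed

lemma subcritical_global_minima:
  assumes "p > 0" and "p * a \<le> 1"
  shows "global_minima (H p) = {0}"
proof -
  have "H p 0 \<le> H p s" for s
    using subcritical_minimum[OF assms, of s] by (cases "s = 0") auto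
  then show ?thesis
    using subcritical_minimum[OF assms] by (auto simp: global_minima_def not_less[symmetric])
qed

lemma subcritical_type:
  assumes "p > 0" and "p * a < 1"
  shows "has_type_strength (H p) 0 2 (p * (1 - p * a))"
  by (rule has_type_strength_2I)
    (use assms in \<open>simp_all add: subcritical_global_minima deriv2_H deriv_H l_0 deriv_l_0\<close>)

text \<open>The second derivative \<open>p * (1 - p * a)\<close> at 0 vanishes, while the minimum
  there stays strict.\<close>

lemma critical_type:
  assumes "p > 0" and "p * a = 1"
  shows "\<exists>n\<ge>4. \<exists>c. has_type_strength (H p) 0 n c"
proof (rule strict_minimum_type)
  show "(H p has_real_derivative deriv (H p) x) (at x)" for x
    using H_has_derivative by (simp add: deriv_H)
qed (use assms in \<open>auto simp: H_extends H_even subcritical_minimum deriv2_H deriv_l_0\<close>)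

lemma V_convex:
  assumes "p > 0"
  shows "convex_on {0<..} (\<lambda>s. s - l (p * s))"
proof (rule convex_on_linorderI)
  fix t x y :: real assume *: "0 < t" "t < 1" "x \<in> {0<..}" "y \<in> {0<..}"
  have "l ((1 - t) * (p * x) + t * (p * y)) \<ge> (1 - t) * l (p * x) + t * l (p * y)"
    using convex_onD[OF l_concave[unfolded concave_on_def], of t "p * x" "p * y"] * assms by simp
  moreover have "p * ((1 - t) * x + t * y) = (1 - t) * (p * x) + t * (p * y)"
    by (simp add: algebra_simps)
  ultimately show "((1 - t) *\<^sub>R x + t *\<^sub>R y) - l (p * ((1 - t) *\<^sub>R x + t *\<^sub>R y))
      \<le> (1 - t) * (x - l (p * x)) + t * (y - l (p * y))"
    by (simp add: algebra_simps)
qed simp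

text \<open>\<open>V s = s - l (p * s)\<close> has slope \<open>1 - p * a < 0\<close> at its zero 0
  and is positive for large \<open>s\<close>; convexity leaves a single positive zero
  \<open>m\<close>. \<open>H p\<close> decreases up to \<open>m\<close> and increases afterwards,
  and evenness gives the mirror image.\<close>

lemma supercritical:
  assumes p: "p > 0" and pa: "p * a > 1"
  obtains m where "m > 0" and "global_minima (H p) = {m, - m}" and "H p m < H p 0"
    and "\<And>c. c = (deriv ^^ 2) (H p) m \<Longrightarrow>
      has_type_strength (H p) m 2 c \<and> has_type_strength (H p) (- m) 2 c"
    and "\<And>x. x > 0 \<Longrightarrow> x = l (p * x) \<longleftrightarrow> x = m"
proof -
  let ?V = "\<lambda>s. s - l (p * s)"
  have "(?V has_real_derivative 1 - p * a) (at 0)"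
    using V_has_derivative[of p 0] by (simp add: deriv_l_0)
  from DERIV_neg_dec_right[OF this] obtain d
    where d: "d > 0" "\<And>h. 0 < h \<Longrightarrow> h < d \<Longrightarrow> ?V h < 0"
    using pa by (auto simp: l_0)
  define h where "h = d / 2"
  have h: "h > 0" "?V h < 0"
    using d(1) d(2)[of h] by (simp_all add: h_def)
  \<comment> \<open>Since \<open>l\<close> is at most 1, \<open>V h < 0\<close> forces
    \<open>h < 1\<close>, and \<open>V 2\<close> is at least 1. The intermediate value theorem thus
    applies between \<open>h\<close> and 2.\<close>
  have "h < 1" "?V 2 > 0"
    using h(2) l_bound[of "p * h"] l_bound[of "p * 2"] by (auto simp: abs_le_iff)
  then obtain m where m: "h \<le> m" "?V m = 0"
    using IVT[of ?V h 0 2] h DERIV_isCont[OF V_has_derivative[of p]] by auto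
  then have "h < m" "m > 0"
    using h by (cases "h = m"; simp)+
  have neg: "?V s < 0" if s: "0 < s" "s < m" for s
  proof -
    \<comment> \<open>Convexity does not reach 0, so the left end of the chord is a point
      \<open>r\<close> below both \<open>s\<close> and \<open>d\<close>, where \<open>V\<close> is
      known to be negative.\<close>
    define r where "r = min d s / 2"
    have r: "0 < r" "r < s" "r < d"
      using s d(1) by (auto simp: r_def)
    have "(m - r) * ?V s \<le> (m - s) * ?V r + (s - r) * ?V m"
      using convex_on_three_points[OF V_convex[OF p], of r m s] r s \<open>m > 0\<close> by simp
    also have "\<dots> < 0"
      using mult_pos_neg[of "m - s" "?V r"] d(2)[of r] r s by (simp only: m(2)) simp
    finally show ?thesis
      using r s by (simp only: mult_less_0_iff) simp
  qed
  have pos: "?V s > 0" if s: "m < s" for s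
  proof -
    \<comment> \<open>Here the zero \<open>m\<close> is the inner point: a negative value at
      \<open>h\<close> must be balanced by a positive one at \<open>s\<close>.\<close>
    have "(s - h) * ?V m \<le> (s - m) * ?V h + (m - h) * ?V s"
      using convex_on_three_points[OF V_convex[OF p], of h s m] s \<open>h < m\<close> h by simp
    moreover have "(s - m) * ?V h < 0"
      using s h(2) by (intro mult_pos_neg) auto
    ultimately have "(m - h) * ?V s > 0"
      unfolding m(2) by linarith
    then show ?thesis
      using \<open>h < m\<close> by (simp only: zero_less_mult_iff) simp
  qed
  have min_pos: "H p m < H p s" if "s \<ge> 0" "s \<noteq> m" for s
  proof (cases "s < m")
    case True
    then show ?thesis
      using neg that by (intro H_decreasing[OF p]) force+
  next
    case False
    then show ?thesis
      using pos that \<open>m > 0\<close> by (intro H_increasing[OF p]) force+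
  qed
  have min: "H p m < H p s" if "s \<noteq> m" "s \<noteq> - m" for s
  proof -
    have "H p m < H p \<bar>s\<bar>"
      using that by (intro min_pos) auto
    then show ?thesis
      using H_even[of p s] by (simp add: abs_if split: if_splits)
  qed
  have glob: "global_minima (H p) = {m, - m}"
  proof (intro equalityI subsetI)
    fix x assume "x \<in> global_minima (H p)"
    then have "H p x \<le> H p m"
      by (simp add: global_minima_def)
    then show "x \<in> {m, - m}"
      using min[of x] by force
  next
    fix x assume "x \<in> {m, - m}"
    then have "H p x = H p m"
      by (auto simp: H_even)
    moreover have "H p m \<le> H p s" for s
      using min[of s] H_even[of p m] by (cases "s = m \<or> s = - m") auto
    ultimately show "x \<in> global_minima (H p)"
      by (simp add: global_minima_def)
  qed
  \<comment> \<open>The tangent at \<open>m\<close> lies below \<open>V\<close>. As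
    \<open>V h < 0 = V m\<close> with \<open>h < m\<close>, its slope is positive, and so is the
    second derivative of \<open>H p\<close> at \<open>m\<close>.\<close>
  have "?V h - ?V m \<ge> (1 - p * deriv l (p * m)) * (h - m)"
    by (rule convex_on_imp_above_tangent[OF V_convex[OF p]])
      (use h \<open>m > 0\<close> in \<open>auto simp: interior_open intro!: has_field_derivative_at_within V_has_derivative\<close>)
  then have "(1 - p * deriv l (p * m)) * (h - m) < 0"
    using h(2) unfolding m(2) by linarith
  then have curv: "(deriv ^^ 2) (H p) m > 0"
    using \<open>h < m\<close> p by (simp add: deriv2_H mult_less_0_iff)
  have "(deriv ^^ 2) (H p) (- m) = (- 1) ^ 2 * (deriv ^^ 2) (H p) m"
  proof (intro higher_deriv_even extends_to_strip_smooth H_extends H_even)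
    show "(H p has_real_derivative deriv (H p) x) (at x)" for x
      using H_has_derivative by (simp add: deriv_H)
  qed (use p in simp)
  then have "has_type_strength (H p) m 2 c \<and> has_type_strength (H p) (- m) 2 c"
    if "c = (deriv ^^ 2) (H p) m" for c
    using that curv glob m(2)
    by (intro conjI has_type_strength_2I) (auto simp: deriv_H l_odd)
  moreover have "x = l (p * x) \<longleftrightarrow> x = m" if "x > 0" for x
    using neg[of x] pos[of x] m(2) that by (cases x m rule: linorder_cases) auto
  ultimately show thesis
    using that[OF \<open>m > 0\<close> glob] min_pos[of 0] \<open>m > 0\<close> by simp
qed

end

section \<open>Transfer to \<open>G\<close> and identification of the critical value\<close>

theorem theorem4p2:
  fixes E :: "'a::metric_space set" and T :: "'a \<Rightarrow> 'a" and \<mu> :: "'a measure"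
    and f :: "'a \<Rightarrow> real" and a J :: real
  assumes "compact E"
    and "T \<in> E \<rightarrow> E" and "continuous_on E T"
    and "uniquely_ergodic E T \<mu>"
    and "f \<in> E \<rightarrow> {0..1}" and "continuous_on E f"
    and "(\<integral>y. f y \<partial>\<mu>) = 1 / 2"
    and "a = (\<integral>y. 4 * f y * (1 - f y) \<partial>\<mu>)" and "a > 0"
    and "J > 0"
    and "\<forall>u. Lam \<mu> f (- u) = Lam \<mu> f u"
    and "concave_on {0<..} (deriv (Lam \<mu> f))"
  shows "beta_c \<mu> f J = 1 / (J * a)
    \<and> (\<forall>\<beta>. 0 < \<beta> \<and> \<beta> < beta_c \<mu> f J \<longrightarrow>
          global_minima (G \<mu> f J \<beta>) = {0} \<and>
          has_type_strength (G \<mu> f J \<beta>) 0 2 (\<beta> * J * (1 - \<beta> * J * a)))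
    \<and> (\<forall>\<beta>. \<beta> = beta_c \<mu> f J \<longrightarrow>
          global_minima (G \<mu> f J \<beta>) = {0} \<and>
          (\<exists>n c. n \<ge> 4 \<and> has_type_strength (G \<mu> f J \<beta>) 0 n c))
    \<and> (\<forall>\<beta>. \<beta> > beta_c \<mu> f J \<longrightarrow>
          (\<exists>m>0. global_minima (G \<mu> f J \<beta>) = {m, - m} \<and>
             (\<exists>c. has_type_strength (G \<mu> f J \<beta>) m 2 c \<and>
                  has_type_strength (G \<mu> f J \<beta>) (- m) 2 c) \<and>
             (\<forall>x>0. x = (\<integral>y. (tanh (\<beta> * J * x) + (2 * f y - 1))
                              / (1 + (2 * f y - 1) * tanh (\<beta> * J * x)) \<partial>\<mu>)
                    \<longleftrightarrow> x = m)))"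
proof -
  have sets: "sets \<mu> = sets (restrict_space borel E)" and "prob_space \<mu>"
    using assms(4) by (auto simp: uniquely_ergodic_def invariant_borel_prob_def)
  have space: "space \<mu> = E"
    using sets_eq_imp_space_eq[OF sets] by (simp add: space_restrict_space)
  have "f \<in> borel_measurable \<mu>"
    using borel_measurable_continuous_on_restrict[OF assms(6)] measurable_cong_sets[OF sets refl]
    by blast
  then interpret F: random_field \<mu> f
    using \<open>prob_space \<mu>\<close> assms(5) by (auto simp: random_field_def random_field_axioms_def space Pi_iff)
  \<comment> \<open>This turns the concavity assumption on \<open>deriv (Lam \<mu> f)\<close> into
    one on the explicit integral.\<close>
  have deriv_Lam: "deriv (Lam \<mu> f) = F.dLam"
    by (rule ext) (rule DERIV_imp_deriv[OF F.Lam_has_derivative])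
  interpret mean_field "Lam \<mu> f" F.dLam a
  proof
    show "(F.dLam has_real_derivative a) (at 0)"
      using F.dLam_has_derivative_0 assms(8) by (simp add: F.moment_def)
    show "concave_on {0<..} F.dLam"
      using assms(12) by (simp add: deriv_Lam)
  qed (use assms(9,11) F.Lam_has_derivative F.dLam_extends F.abs_dLam in auto)
  have G: "G \<mu> f J \<beta> = H (\<beta> * J)" for \<beta>
    by (simp add: G_def H_def fun_eq_iff)
  have Ja: "J * a > 0"
    using \<open>J > 0\<close> \<open>a > 0\<close> by simp
  \<comment> \<open>At 0 the argument of the logarithm is \<open>f y + (1 - f y) = 1\<close>.
    Nonnegativity of \<open>G\<close> therefore says exactly that 0 is a global minimum
    point.\<close>
  have H_0: "H p 0 = 0" for p
    by (simp add: H_def Lam_def)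
  \<comment> \<open>Beyond \<open>1 / (J * a)\<close> the value at \<open>m\<close> is below
    \<open>H p 0 = 0\<close>; up to and including it, 0 is a minimum point. The supremum is the
    right end of this nonempty interval.\<close>
  have "{\<beta>. \<beta> > 0 \<and> (\<forall>s. G \<mu> f J \<beta> s \<ge> 0)} = {0<..1 / (J * a)}"
  proof (intro equalityI subsetI)
    fix \<beta> assume "\<beta> \<in> {\<beta>. \<beta> > 0 \<and> (\<forall>s. G \<mu> f J \<beta> s \<ge> 0)}"
    then have \<beta>: "\<beta> > 0" "\<And>s. H (\<beta> * J) s \<ge> 0"
      by (auto simp: G)
    have "\<not> \<beta> * J * a > 1"
    proof
      assume "\<beta> * J * a > 1"
      then obtain m where "H (\<beta> * J) m < H (\<beta> * J) 0"
        using supercritical[of "\<beta> * J"] \<beta>(1) \<open>J > 0\<close> by (metis mult_pos_pos)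
      then show False
        using \<beta>(2)[of m] by (simp add: H_0)
    qed
    then show "\<beta> \<in> {0<..1 / (J * a)}"
      using \<beta>(1) Ja by (simp add: field_simps)
  next
    fix \<beta> assume "\<beta> \<in> {0<..1 / (J * a)}"
    then have \<beta>: "\<beta> > 0" "\<beta> * J * a \<le> 1"
      using Ja by (auto simp: field_simps)
    then have "0 \<in> global_minima (H (\<beta> * J))"
      using subcritical_global_minima[of "\<beta> * J"] \<open>J > 0\<close> by simp
    then show "\<beta> \<in> {\<beta>. \<beta> > 0 \<and> (\<forall>s. G \<mu> f J \<beta> s \<ge> 0)}"
      using \<beta>(1) by (simp add: G global_minima_def H_0)
  qed
  then have beta_c: "beta_c \<mu> f J = 1 / (J * a)"
    using Ja by (simp add: beta_c_def cSup_greaterThanAtMost)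
  show ?thesis
    unfolding beta_c G
  proof (intro conjI allI impI refl)
    fix \<beta> assume "0 < \<beta> \<and> \<beta> < 1 / (J * a)"
    then have "\<beta> * J > 0" "\<beta> * J * a < 1"
      using Ja \<open>J > 0\<close> by (auto simp: field_simps)
    then show "global_minima (H (\<beta> * J)) = {0}"
      and "has_type_strength (H (\<beta> * J)) 0 2 (\<beta> * J * (1 - \<beta> * J * a))"
      using subcritical_global_minima subcritical_type by auto
  next
    fix \<beta> assume "\<beta> = 1 / (J * a)"
    then have "\<beta> * J > 0" "\<beta> * J * a = 1"
      using \<open>a > 0\<close> \<open>J > 0\<close> by auto
    then show "global_minima (H (\<beta> * J)) = {0}"
      and "\<exists>n c. n \<ge> 4 \<and> has_type_strength (H (\<beta> * J)) 0 n c"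
      using subcritical_global_minima critical_type by auto
  next
    fix \<beta> :: real assume *: "\<beta> > 1 / (J * a)"
    moreover have "1 / (J * a) > 0"
      using Ja by simp
    ultimately have "\<beta> > 0"
      by linarith
    then have "\<beta> * J > 0" "\<beta> * J * a > 1"
      using * Ja \<open>J > 0\<close> by (auto simp: field_simps)
    from supercritical[OF this] obtain m where "m > 0" "global_minima (H (\<beta> * J)) = {m, - m}"
      "\<exists>c. has_type_strength (H (\<beta> * J)) m 2 c \<and> has_type_strength (H (\<beta> * J)) (- m) 2 c"
      "\<And>x. x > 0 \<Longrightarrow> x = F.dLam (\<beta> * J * x) \<longleftrightarrow> x = m"
      by metis
    then show "\<exists>m>0. global_minima (H (\<beta> * J)) = {m, - m} \<and>
        (\<exists>c. has_type_strength (H (\<beta> * J)) m 2 c \<and> has_type_strength (H (\<beta> * J)) (- m) 2 c) \<and>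
        (\<forall>x>0. x = (\<integral>y. (tanh (\<beta> * J * x) + (2 * f y - 1))
            / (1 + (2 * f y - 1) * tanh (\<beta> * J * x)) \<partial>\<mu>) \<longleftrightarrow> x = m)"
      unfolding F.dLam_def by blast
  qed
qed

end
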